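(* Let $N,T,D\in\mathbb N$ and let $\mathbf z_{1:T}=(\mathbf z_t^n)_{t\in[T],n\in[N]_0}$ be fixed points of $\mathbb R^D$ with $\sum_{l_{1:T}\in[N]_0^T}\boldsymbol\pi_{T,D}(\mathbf z_1^{l_1},\dots,\mathbf z_T^{l_T})>0$. Let $\xi_T(\mathbf z_{1:T},\cdot)$ be the probability distribution on $[N]_0^T$ given by $$\xi_T(\mathbf z_{1:T},\{k_{1:T}\})=\frac{\boldsymbol\pi_{T,D}(\mathbf z_1^{k_1},\dots,\mathbf z_T^{k_T})}{\sum_{l_{1:T}\in[N]_0^T}\boldsymbol\pi_{T,D}(\mathbf z_1^{l_1},\dots,\mathbf z_T^{l_T})}.$$ Then the Markov kernel on $[N]_0^T$ which maps reference indices $j_{1:T}$ to new indices $K_{1:T}$ through the resampling, final-index-selection and ancestor-tracing steps of the i-RW-CSMC algorithm (without backward sampling), as described in the context, leaves $\xi_T(\mathbf z_{1:T},\cdot)$ invariant.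
   Context: Notation: $[n]=\{1,\dots,n\}$, $[n]_0=\{0,\dots,n\}$. Quantities with time index $0$ are ignored (so $\mathbf m_1(\mathbf x_0,\mathbf x_1)\equiv\mathbf m_1(\mathbf x_1)$). Model: $\mathbf m_1$ is a probability density on $\mathbb R^D$; $\mathbf m_t(\mathbf x,\mathbf y)$, $t\ge2$, is a Markov transition density on $\mathbb R^D$; $\mathbf G_t:\mathbb R^D\to(0,\infty)$ is measurable; $\boldsymbol\pi_{T,D}(\mathbf x_{1:T})\propto\mathbf m_1(\mathbf x_1)\mathbf G_1(\mathbf x_1)\prod_{t=2}^T\mathbf m_t(\mathbf x_{t-1},\mathbf x_t)\mathbf G_t(\mathbf x_t)$ is a probability density on $(\mathbb R^D)^T$. The kernel $j_{1:T}\mapsto K_{1:T}$ (particles $\mathbf z_{1:T}$ fixed; $j_t$ is the index of the reference particle at time $t$): 1. For $t=1,\dots,T-1$: set $A_t^{j_{t+1}}=j_t$ and, conditionally independently for $n\in[N]_0\setminus\{j_{t+1}\}$, sample $A_t^n=l\in[N]_0$ with probability $\frac{\mathbf m_t(\mathbf z_{t-1}^{A_{t-1}^l},\mathbf z_t^l)\mathbf G_t(\mathbf z_t^l)}{\sum_{m=0}^N\mathbf m_t(\mathbf z_{t-1}^{A_{t-1}^m},\mathbf z_t^m)\mathbf G_t(\mathbf z_t^m)}$. 2. Sample $K_T=k\in[N]_0$ with probability $\frac{\mathbf m_T(\mathbf z_{T-1}^{A_{T-1}^k},\mathbf z_T^k)\mathbf G_T(\mathbf z_T^k)}{\sum_{m=0}^N\mathbf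 m_T(\mathbf z_{T-1}^{A_{T-1}^m},\mathbf z_T^m)\mathbf G_T(\mathbf z_T^m)}$. 3. For $t=T-1,\dots,1$ set $K_t=A_t^{K_{t+1}}$. These probabilities are well defined whenever $\xi_T(\mathbf z_{1:T},\{j_{1:T}\})>0$; for other $j_{1:T}$ the kernel may be defined arbitrarily. *)

theory Defs
  imports "HOL-Probability.Probability"
begin

definition prob_density :: "'a measure \<Rightarrow> ('a \<Rightarrow> real) \<Rightarrow> bool" where
  "prob_density M f \<longleftrightarrow>
     f \<in> borel_measurable M \<and> (\<forall>x\<in>space M. 0 \<le> f x) \<and> (\<integral>\<^sup>+x. ennreal (f x) \<partial>M) = 1"

definition transition_density :: "(real^'d \<Rightarrow> real^'d \<Rightarrow> real) \<Rightarrow> bool" where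
  "transition_density k \<longleftrightarrow>
     (\<lambda>(x, y). k x y) \<in> borel_measurable (borel \<Otimes>\<^sub>M borel) \<and> (\<forall>x. prob_density lborel (k x))"

text \<open>
  The arguments \<open>m1\<close>, \<open>m\<close> and \<open>G\<close> are the initial density, the transition densities
  \<open>m t\<close> for \<open>t \<in> {2..T}\<close> and the potentials \<open>G t\<close> for \<open>t \<in> {1..T}\<close>.
  A path is a function on \<open>{1..T}\<close>, and Lebesgue measure on the path space is
  \<open>\<Pi>\<^sub>M t\<in>{1..T}. lborel\<close>.
\<close>

definition unnormalised_target ::
  "nat \<Rightarrow> (real^'d \<Rightarrow> real) \<Rightarrow> (nat \<Rightarrow> real^'d \<Rightarrow> real^'d \<Rightarrow> real) \<Rightarrow> (nat \<Rightarrow> real^'d \<Rightarrow> real) \<Rightarrow>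
   (nat \<Rightarrow> real^'d) \<Rightarrow> real" where
  "unnormalised_target T m1 m G x =
     m1 (x 1) * G 1 (x 1) * (\<Prod>t=2..T. m t (x (t - 1)) (x t) * G t (x t))"

text \<open>
  If the normalising constant is not in \<open>(0, \<infinity>)\<close>, the Bochner integral below is \<open>0\<close> and so is
  the quotient; the requirement that \<open>target_density\<close> be a probability density therefore
  excludes this case.
\<close>

definition target_density ::
  "nat \<Rightarrow> (real^'d \<Rightarrow> real) \<Rightarrow> (nat \<Rightarrow> real^'d \<Rightarrow> real^'d \<Rightarrow> real) \<Rightarrow> (nat \<Rightarrow> real^'d \<Rightarrow> real) \<Rightarrow>
   (nat \<Rightarrow> real^'d) \<Rightarrow> real" where
  "target_density T m1 m G x =
     unnormalised_target T m1 m G x /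
     (\<integral>y. unnormalised_target T m1 m G y \<partial>(\<Pi>\<^sub>M t\<in>{1..T}. lborel))"

text \<open>The distribution on a finite set \<open>S\<close> with probabilities proportional to \<open>w\<close>; it is
  an unspecified distribution if the weights on \<open>S\<close> sum to \<open>0\<close>.\<close>

definition categorical_pmf :: "'a set \<Rightarrow> ('a \<Rightarrow> real) \<Rightarrow> 'a pmf" where
  "categorical_pmf S w = embed_pmf (\<lambda>l. if l \<in> S then w l / (\<Sum>i\<in>S. w i) else 0)"

lemma pmf_categorical_pmf:
  assumes "finite S" and nonneg: "\<And>l. l \<in> S \<Longrightarrow> 0 \<le> w l" and pos: "0 < (\<Sum>i\<in>S. w i)"
  shows "pmf (categorical_pmf S w) l = (if l \<in> S then w l / (\<Sum>i\<in>S. w i) else 0)"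
  unfolding categorical_pmf_def
proof (rule pmf_embed_pmf)
  let ?p = "\<lambda>l. if l \<in> S then w l / (\<Sum>i\<in>S. w i) else 0"
  show nn: "0 \<le> ?p l" for l
    using nonneg pos by simp
  have "(\<integral>\<^sup>+l. ennreal (?p l) \<partial>count_space UNIV) = (\<Sum>l\<in>S. ennreal (?p l))"
    using \<open>finite S\<close> by (intro nn_integral_count_space') auto
  also have "\<dots> = ennreal (\<Sum>l\<in>S. ?p l)"
    using nn by (intro sum_ennreal)
  also have "(\<Sum>l\<in>S. ?p l) = 1"
    using pos by (simp flip: sum_divide_distrib)
  finally show "(\<integral>\<^sup>+l. ennreal (?p l) \<partial>count_space UNIV) = 1"
    by simp
qed

definition index_paths :: "nat \<Rightarrow> nat \<Rightarrow> (nat \<Rightarrow> nat) set" where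
  "index_paths N T = {1..T} \<rightarrow>\<^sub>E {0..N}"

text \<open>Throughout, \<open>z t n\<close> is the particle with index \<open>n\<close> at time \<open>t\<close>.\<close>

definition selected_path :: "nat \<Rightarrow> (nat \<Rightarrow> nat \<Rightarrow> 'a) \<Rightarrow> (nat \<Rightarrow> nat) \<Rightarrow> nat \<Rightarrow> 'a" where
  "selected_path T z k = (\<lambda>t\<in>{1..T}. z t (k t))"

definition xi ::
  "nat \<Rightarrow> nat \<Rightarrow> (real^'d \<Rightarrow> real) \<Rightarrow> (nat \<Rightarrow> real^'d \<Rightarrow> real^'d \<Rightarrow> real) \<Rightarrow>
   (nat \<Rightarrow> real^'d \<Rightarrow> real) \<Rightarrow> (nat \<Rightarrow> nat \<Rightarrow> real^'d) \<Rightarrow> (nat \<Rightarrow> nat) pmf" where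
  "xi N T m1 m G z =
     categorical_pmf (index_paths N T) (\<lambda>k. target_density T m1 m G (selected_path T z k))"

text \<open>
  \<open>A t n\<close> is the time-\<open>t\<close> ancestor index of particle \<open>n\<close> at time \<open>t + 1\<close>. For \<open>t = 1\<close> the
  weight does not involve the (meaningless) values \<open>z 0\<close> and \<open>A 0\<close>.
\<close>

definition particle_weight ::
  "(real^'d \<Rightarrow> real) \<Rightarrow> (nat \<Rightarrow> real^'d \<Rightarrow> real^'d \<Rightarrow> real) \<Rightarrow> (nat \<Rightarrow> real^'d \<Rightarrow> real) \<Rightarrow>
   (nat \<Rightarrow> nat \<Rightarrow> real^'d) \<Rightarrow> (nat \<Rightarrow> nat \<Rightarrow> nat) \<Rightarrow> nat \<Rightarrow> nat \<Rightarrow> real" where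
  "particle_weight m1 m G z A t l =
     (if t = 1 then m1 (z t l) else m t (z (t - 1) (A (t - 1) l)) (z t l)) * G t (z t l)"

text \<open>
  Joint law of the ancestor indices at times \<open>1, \<dots>, s\<close> given the reference indices \<open>j\<close>. The
  product \<open>Pi_pmf\<close> makes the indices \<open>A t n\<close>, \<open>n \<in> {0..N}\<close>, independent given the earlier ones.
  All entries of \<open>A\<close> outside \<open>{1..s} \<times> {0..N}\<close> have the dummy value \<open>0\<close>.
\<close>

primrec resampling_pmf ::
  "nat \<Rightarrow> (real^'d \<Rightarrow> real) \<Rightarrow> (nat \<Rightarrow> real^'d \<Rightarrow> real^'d \<Rightarrow> real) \<Rightarrow> (nat \<Rightarrow> real^'d \<Rightarrow> real) \<Rightarrow>
   (nat \<Rightarrow> nat \<Rightarrow> real^'d) \<Rightarrow> (nat \<Rightarrow> nat) \<Rightarrow> nat \<Rightarrow> (nat \<Rightarrow> nat \<Rightarrow> nat) pmf" where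
  "resampling_pmf N m1 m G z j 0 = return_pmf (\<lambda>_ _. 0)"
| "resampling_pmf N m1 m G z j (Suc s) =
     do {
       A \<leftarrow> resampling_pmf N m1 m G z j s;
       a \<leftarrow> Pi_pmf {0..N} 0 (\<lambda>n.
              if n = j (Suc s + 1) then return_pmf (j (Suc s))
              else categorical_pmf {0..N} (particle_weight m1 m G z A (Suc s)));
       return_pmf (A(Suc s := a))
     }"

text \<open>\<open>ancestor T A k s\<close> is the index at time \<open>T - s\<close> of the lineage of particle \<open>k\<close> at time \<open>T\<close>.\<close>

primrec ancestor :: "nat \<Rightarrow> (nat \<Rightarrow> nat \<Rightarrow> nat) \<Rightarrow> nat \<Rightarrow> nat \<Rightarrow> nat" where
  "ancestor T A k 0 = k"
| "ancestor T A k (Suc s) = A (T - Suc s) (ancestor T A k s)"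

definition trace_ancestors :: "nat \<Rightarrow> (nat \<Rightarrow> nat \<Rightarrow> nat) \<Rightarrow> nat \<Rightarrow> nat \<Rightarrow> nat" where
  "trace_ancestors T A k = (\<lambda>t\<in>{1..T}. ancestor T A k (T - t))"

lemma trace_ancestors_final: "1 \<le> T \<Longrightarrow> trace_ancestors T A k T = k"
  by (simp add: trace_ancestors_def)

lemma trace_ancestors_step:
  assumes "t \<in> {1..T-1}"
  shows "trace_ancestors T A k t = A t (trace_ancestors T A k (t + 1))"
proof -
  have "T - t = Suc (T - (t + 1))" "T - Suc (T - (t + 1)) = t" "t \<in> {1..T}" "t + 1 \<in> {1..T}"
    using assms by auto
  then show ?thesis
    unfolding trace_ancestors_def by (simp only: restrict_apply' ancestor.simps)
qed

definition csmc_kernel ::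
  "nat \<Rightarrow> nat \<Rightarrow> (real^'d \<Rightarrow> real) \<Rightarrow> (nat \<Rightarrow> real^'d \<Rightarrow> real^'d \<Rightarrow> real) \<Rightarrow>
   (nat \<Rightarrow> real^'d \<Rightarrow> real) \<Rightarrow> (nat \<Rightarrow> nat \<Rightarrow> real^'d) \<Rightarrow> (nat \<Rightarrow> nat) \<Rightarrow> (nat \<Rightarrow> nat) pmf" where
  "csmc_kernel N T m1 m G z j =
     do {
       A \<leftarrow> resampling_pmf N m1 m G z j (T - 1);
       k \<leftarrow> categorical_pmf {0..N} (particle_weight m1 m G z A T);
       return_pmf (trace_ancestors T A k)
     }"

end

(*
The kernel is one sweep of a Gibbs sampler on pairs (j, A) of reference path and ancestor array.
With w_t the particle weights at time t and S_t their sum, the target density at j is proportional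
to the product of the w_t(j_t), provided that A traces j. Each factor w_t(j_t) is S_t times the
probability of drawing the index j_t = A_t(j_(t+1)) that resampling forced on A. Hence the joint
law of (j, A) is a function of A alone times the law of the path traced back from the final index,
and the selection and tracing steps draw j from its conditional law given A.
*)
theory Submission
  imports Defs
begin

section \<open>Gibbs steps on discrete laws, categorical laws and product laws\<close>

text \<open>Summing \<open>joint\<close> over \<open>a\<close> shows that \<open>h\<close> is the
  marginal law of \<open>b\<close>, because \<open>S b\<close> has mass 1. So \<open>S b\<close> is
  the conditional law of \<open>a\<close> given \<open>b\<close>, and summing over \<open>b\<close>
  gives back \<open>p\<close>, because \<open>R a\<close> has mass 1.\<close>

lemma bind_pmf_invariantI:
  fixes p :: "'a pmf" and R :: "'a \<Rightarrow> 'b pmf" and S :: "'b \<Rightarrow> 'a pmf" and h :: "'b \<Rightarrow> real"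
  assumes nonneg: "\<And>b. 0 \<le> h b"
    and joint: "\<And>a b. pmf p a * pmf (R a) b = h b * pmf (S b) a"
  shows "bind_pmf p (\<lambda>a. bind_pmf (R a) S) = p"
proof -
  let ?q = "bind_pmf p R"
  have q: "pmf ?q b = h b" for b
  proof -
    have "ennreal (pmf ?q b) = (\<integral>\<^sup>+a. ennreal (pmf p a) * ennreal (pmf (R a) b) \<partial>count_space UNIV)"
      by (simp add: ennreal_pmf_bind nn_integral_measure_pmf)
    also have "\<dots> = (\<integral>\<^sup>+a. ennreal (h b) * ennreal (pmf (S b) a) \<partial>count_space UNIV)"
      by (simp add: joint nonneg flip: ennreal_mult)
    also have "\<dots> = ennreal (h b)"
      by (simp add: nn_integral_cmult nn_integral_pmf_eq_1)
    finally show ?thesis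
      using nonneg by simp
  qed
  have "bind_pmf ?q S = p"
  proof (rule pmf_eqI)
    fix a
    have "ennreal (pmf (bind_pmf ?q S) a) =
        (\<integral>\<^sup>+b. ennreal (pmf ?q b) * ennreal (pmf (S b) a) \<partial>count_space UNIV)"
      by (simp add: ennreal_pmf_bind nn_integral_measure_pmf)
    also have "\<dots> = (\<integral>\<^sup>+b. ennreal (pmf p a) * ennreal (pmf (R a) b) \<partial>count_space UNIV)"
      by (simp add: q joint nonneg flip: ennreal_mult)
    also have "\<dots> = ennreal (pmf p a)"
      by (simp add: nn_integral_cmult nn_integral_pmf_eq_1)
    finally show "pmf (bind_pmf ?q S) a = pmf p a"
      by simp
  qed
  then show ?thesis
    by (simp add: bind_assoc_pmf)
qed

text \<open>The update at \<open>s\<close> destroys only the known value \<open>c\<close>, so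
  \<open>g\<close> arises from exactly one pair: \<open>f = g(s := c)\<close> and
  \<open>a = g s\<close>.\<close>

lemma pmf_bind_fun_upd:
  fixes M :: "('a \<Rightarrow> 'b) pmf" and K :: "('a \<Rightarrow> 'b) \<Rightarrow> 'b pmf"
  assumes default: "\<And>f. f \<in> set_pmf M \<Longrightarrow> f s = c"
  shows "pmf (bind_pmf M (\<lambda>f. bind_pmf (K f) (\<lambda>a. return_pmf (f(s := a))))) g =
    pmf M (g(s := c)) * pmf (K (g(s := c))) (g s)"
proof -
  have "pmf (bind_pmf (K f) (\<lambda>a. return_pmf (f(s := a)))) g =
      indicator {g(s := c)} f * pmf (K (g(s := c))) (g s)" if "f \<in> set_pmf M" for f
  proof (cases "f = g(s := c)")
    case True
    then have "inj (\<lambda>a. f(s := a))" "g = f(s := g s)"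
      by (auto intro!: injI dest: fun_upd_eqD)
    then show ?thesis
      using True pmf_map_inj'[of "\<lambda>a. f(s := a)" "K f" "g s"] by (simp add: map_pmf_def)
  next
    case False
    then have "f(s := a) \<noteq> g" for a
      using default[OF that] by (metis fun_upd_triv fun_upd_upd)
    then show ?thesis
      using False by (auto simp: pmf_eq_0_set_pmf)
  qed
  then have "pmf (bind_pmf M (\<lambda>f. bind_pmf (K f) (\<lambda>a. return_pmf (f(s := a))))) g =
      (\<integral>f. indicator {g(s := c)} f * pmf (K (g(s := c))) (g s) \<partial>M)"
    unfolding pmf_bind by (intro integral_cong_AE) (auto simp: AE_measure_pmf_iff)
  then show ?thesis
    by (simp add: pmf.rep_eq)
qed

text \<open>The form without division covers total weight 0 as well: then every weight on
  \<open>S\<close> vanishes, and so do both sides, whatever the unspecified distribution is.\<close>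

lemma categorical_pmf_sum_times:
  assumes "finite S" "\<And>l. l \<in> S \<Longrightarrow> 0 \<le> w l" "k \<in> S"
  shows "(\<Sum>i\<in>S. w i) * pmf (categorical_pmf S w) k = w k"
proof (cases "(\<Sum>i\<in>S. w i) = 0")
  case True
  then show ?thesis
    using assms by (simp add: sum_nonneg_eq_0_iff)
next
  case False
  then have "0 < (\<Sum>i\<in>S. w i)"
    using assms by (simp add: less_le sum_nonneg)
  then show ?thesis
    using assms by (simp add: pmf_categorical_pmf)
qed

lemma set_categorical_pmf_subset:
  assumes "finite S" "\<And>l. l \<in> S \<Longrightarrow> 0 \<le> w l" "(\<Sum>i\<in>S. w i) \<noteq> 0"
  shows "set_pmf (categorical_pmf S w) \<subseteq> S"
proof -
  have "0 < (\<Sum>i\<in>S. w i)"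
    using assms by (simp add: less_le sum_nonneg)
  then show ?thesis
    using assms by (auto simp: set_pmf_iff pmf_categorical_pmf split: if_splits)
qed

text \<open>Coordinate \<open>i\<close> contributes the factor 1 on the left and
  \<open>pmf p b\<close> on the right. This is how the weight of a reference index is traded for the
  total weight.\<close>

lemma Pi_pmf_forced_coordinate:
  fixes p :: "'b pmf" and w c :: real
  assumes "finite I" "i \<in> I" "f i = b" "c * pmf p b = w"
  shows "pmf (Pi_pmf I d (\<lambda>n. if n = i then return_pmf b else p)) f * w =
    pmf (Pi_pmf I d (\<lambda>_. p)) f * c"
proof -
  have "(\<Prod>n\<in>I - {i}. pmf (if n = i then return_pmf b else p) (f n)) =
      (\<Prod>n\<in>I - {i}. pmf p (f n))"
    by (intro prod.cong) auto
  then show ?thesis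
    using assms by (auto simp: pmf_Pi prod.remove[of I i] indicator_def)
qed

section \<open>The law of the ancestor indices\<close>

lemma particle_weight_fun_upd:
  "t \<le> Suc s \<Longrightarrow>
   particle_weight m1 m G z (A(Suc s := a)) t = particle_weight m1 m G z A t"
  by (auto simp: particle_weight_def fun_eq_iff)

lemma resampling_pmf_default:
  "A \<in> set_pmf (resampling_pmf N m1 m G z j s) \<Longrightarrow> s < t \<Longrightarrow> A t = (\<lambda>_. 0)"
  by (induction s arbitrary: A) auto

text \<open>Row \<open>Suc s\<close> still has its dummy value before it is drawn, so erasing it
  from \<open>A\<close> recovers the earlier array. The weights at time \<open>Suc s\<close> read
  only row \<open>s\<close> and can be computed from \<open>A\<close> itself.\<close>

lemma pmf_resampling_pmf_Suc:
  "pmf (resampling_pmf N m1 m G z j (Suc s)) A =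
    pmf (resampling_pmf N m1 m G z j s) (A(Suc s := \<lambda>_. 0)) *
    pmf (Pi_pmf {0..N} 0 (\<lambda>n. if n = j (Suc s + 1) then return_pmf (j (Suc s))
      else categorical_pmf {0..N} (particle_weight m1 m G z A (Suc s)))) (A (Suc s))"
  unfolding resampling_pmf.simps
  by (subst pmf_bind_fun_upd[where c = "\<lambda>_. 0"])
    (auto simp: particle_weight_fun_upd[OF order_refl] cong: if_cong dest: resampling_pmf_default)

text \<open>The bound on \<open>j (t + 1)\<close> makes it a coordinate of the product law; beyond
  \<open>N\<close> the entry would be the default 0 and not the forced \<open>j t\<close>.\<close>

lemma resampling_pmf_traces_reference:
  assumes "A \<in> set_pmf (resampling_pmf N m1 m G z j s)" "t \<in> {1..s}" "j (t + 1) \<le> N"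
  shows "A t (j (t + 1)) = j t"
  using assms
proof (induction s arbitrary: A)
  case (Suc s)
  then show ?case
    by (cases "t = Suc s") (fastforce simp: set_Pi_pmf PiE_dflt_def)+
qed simp

text \<open>The constant reference \<open>Suc N\<close> is no particle index, so \<open>resampling_pmf\<close> with this
  reference resamples every index and forces none.\<close>

lemma pmf_resampling_pmf_reference:
  assumes nonneg: "\<And>t l. t \<in> {1..s} \<Longrightarrow> 0 \<le> particle_weight m1 m G z A t l"
    and range: "\<And>t. t \<in> {1..s + 1} \<Longrightarrow> j t \<le> N"
    and traced: "\<And>t. t \<in> {1..s} \<Longrightarrow> A t (j (t + 1)) = j t"
  shows "pmf (resampling_pmf N m1 m G z j s) A * (\<Prod>t=1..s. particle_weight m1 m G z A t (j t)) =
    pmf (resampling_pmf N m1 m G z (\<lambda>_. Suc N) s) A *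
    (\<Prod>t=1..s. \<Sum>l=0..N. particle_weight m1 m G z A t l)"
  using assms
proof (induction s arbitrary: A)
  case 0
  show ?case by simp
next
  case (Suc s)
  let ?w = "particle_weight m1 m G z"
  let ?A = "A(Suc s := \<lambda>_. 0)"
  let ?p = "categorical_pmf {0..N} (?w A (Suc s))"
  have w: "?w ?A t = ?w A t" if "t \<in> {1..s}" for t
    using that by (intro particle_weight_fun_upd) auto
  have IH: "pmf (resampling_pmf N m1 m G z j s) ?A * (\<Prod>t=1..s. ?w A t (j t)) =
      pmf (resampling_pmf N m1 m G z (\<lambda>_. Suc N) s) ?A * (\<Prod>t=1..s. \<Sum>l=0..N. ?w A t l)"
  proof -
    have "pmf (resampling_pmf N m1 m G z j s) ?A * (\<Prod>t=1..s. ?w ?A t (j t)) =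
        pmf (resampling_pmf N m1 m G z (\<lambda>_. Suc N) s) ?A * (\<Prod>t=1..s. \<Sum>l=0..N. ?w ?A t l)"
    proof (rule Suc.IH)
      show "0 \<le> ?w ?A t l" if "t \<in> {1..s}" for t l
        unfolding w[OF that] using that Suc.prems(1) by simp
    qed (use Suc.prems in auto)
    then show ?thesis
      by (simp add: w cong: prod.cong_simp)
  qed
  \<comment> \<open>The forced coordinate is the reference index one time later, which is why
    \<open>range\<close> reaches up to \<open>s + 1\<close>.\<close>
  have forced: "pmf (Pi_pmf {0..N} 0 (\<lambda>n. if n = j (Suc s + 1) then return_pmf (j (Suc s)) else ?p))
        (A (Suc s)) * ?w A (Suc s) (j (Suc s)) =
      pmf (Pi_pmf {0..N} 0 (\<lambda>_. ?p)) (A (Suc s)) * (\<Sum>l=0..N. ?w A (Suc s) l)"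
    using Suc.prems by (intro Pi_pmf_forced_coordinate categorical_pmf_sum_times) auto
  have unforced: "Pi_pmf {0..N} 0 (\<lambda>n. if n = Suc N then return_pmf (Suc N) else ?p) =
      Pi_pmf {0..N} 0 (\<lambda>_. ?p)"
    by (intro Pi_pmf_cong) auto
  have steps: "{1..Suc s} = insert (Suc s) {1..s}"
    by auto
  show ?case
    unfolding pmf_resampling_pmf_Suc unforced
    using arg_cong2[OF IH forced, of "(*)"]
    by (simp add: steps mult_ac)
qed

text \<open>Nonzero total weights rule out the unspecified distributions, which might charge indices
  above \<open>N\<close>.\<close>

lemma resampling_pmf_range:
  assumes "A \<in> set_pmf (resampling_pmf N m1 m G z (\<lambda>_. Suc N) s)"
    and "\<And>t l. t \<in> {1..s} \<Longrightarrow> 0 \<le> particle_weight m1 m G z A t l"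
    and "\<And>t. t \<in> {1..s} \<Longrightarrow> (\<Sum>l=0..N. particle_weight m1 m G z A t l) \<noteq> 0"
    and "t \<in> {1..s}" "n \<le> N"
  shows "A t n \<le> N"
  using assms
proof (induction s arbitrary: A)
  case 0
  then show ?case by simp
next
  case (Suc s)
  let ?w = "particle_weight m1 m G z"
  let ?A = "A(Suc s := \<lambda>_. 0)"
  have A: "?A \<in> set_pmf (resampling_pmf N m1 m G z (\<lambda>_. Suc N) s)"
    and last: "A (Suc s) \<in> set_pmf (Pi_pmf {0..N} 0 (\<lambda>n. if n = Suc N then return_pmf (Suc N)
      else categorical_pmf {0..N} (?w A (Suc s))))"
    using Suc.prems(1) unfolding set_pmf_iff pmf_resampling_pmf_Suc by auto
  show ?case
  proof (cases "t = Suc s")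
    case True
    have "A t n \<in> set_pmf (categorical_pmf {0..N} (?w A (Suc s)))"
      using last \<open>n \<le> N\<close> True by (auto simp: set_Pi_pmf PiE_dflt_def split: if_splits)
    also have "\<dots> \<subseteq> {0..N}"
      using Suc.prems by (intro set_categorical_pmf_subset) auto
    finally show ?thesis by simp
  next
    case False
    have w: "?w ?A t = ?w A t" if "t \<in> {1..s}" for t
      using that by (intro particle_weight_fun_upd) auto
    have "?A t n \<le> N"
    proof (rule Suc.IH[OF A])
      show "0 \<le> ?w ?A t l" "(\<Sum>l=0..N. ?w ?A t l) \<noteq> 0" if "t \<in> {1..s}" for t l
        unfolding w[OF that] using that Suc.prems(2,3) by simp_all
    qed (use Suc.prems(4,5) False in auto)
    with False show ?thesis by simp
  qed
qed

section \<open>Tracing lineages back from the final index\<close>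

lemma trace_ancestors_eq_iff:
  assumes "1 \<le> T" "j \<in> extensional {1..T}"
  shows "trace_ancestors T A (j T) = j \<longleftrightarrow> (\<forall>t\<in>{1..T-1}. A t (j (t + 1)) = j t)"
proof
  assume "trace_ancestors T A (j T) = j"
  then show "\<forall>t\<in>{1..T-1}. A t (j (t + 1)) = j t"
    using trace_ancestors_step[of _ T A "j T"] by metis
next
  assume *: "\<forall>t\<in>{1..T-1}. A t (j (t + 1)) = j t"
  have "ancestor T A (j T) s = j (T - s)" if "s < T" for s
    using that
  proof (induction s)
    case (Suc s)
    then have "A (T - Suc s) (j (T - Suc s + 1)) = j (T - Suc s)"
      using Suc.prems by (intro bspec[OF *]) auto
    with Suc show ?case
      by (simp add: Suc_diff_Suc)
  qed simp
  then show "trace_ancestors T A (j T) = j"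
    using assms by (intro extensionalityI[of _ "{1..T}"]) (auto simp: trace_ancestors_def)
qed

lemma trace_ancestors_in_index_paths:
  assumes "k \<le> N" "\<And>t n. t \<in> {1..T-1} \<Longrightarrow> n \<le> N \<Longrightarrow> A t n \<le> N"
  shows "trace_ancestors T A k \<in> index_paths N T"
proof -
  have "ancestor T A k s \<le> N" if "s < T" for s
    using that
  proof (induction s)
    case (Suc s)
    then have "T - Suc s \<in> {1..T-1}"
      by auto
    with Suc show ?case
      using assms(2) by simp
  qed (use assms(1) in simp)
  then show ?thesis
    by (auto simp: trace_ancestors_def index_paths_def)
qed

text \<open>A traced path keeps its starting index as its value at \<open>T\<close>, so tracing is
  injective and only \<open>j T\<close> can lead to \<open>j\<close>.\<close>

lemma pmf_map_trace_ancestors: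
  assumes "1 \<le> T"
  shows "pmf (map_pmf (trace_ancestors T A) p) j =
    pmf p (j T) * of_bool (trace_ancestors T A (j T) = j)"
proof (cases "trace_ancestors T A (j T) = j")
  case True
  have "inj (trace_ancestors T A)"
    using assms by (metis injI trace_ancestors_final)
  from pmf_map_inj'[OF this, of p "j T"] show ?thesis
    using True by simp
next
  case False
  have "j \<notin> trace_ancestors T A ` set_pmf p"
    using False trace_ancestors_final[OF assms] by (metis imageE)
  then show ?thesis
    using False by (simp add: pmf_eq_0_set_pmf)
qed

text \<open>If \<open>A\<close> traces \<open>j\<close>, the parent of \<open>j t\<close> is
  \<open>j (t - 1)\<close>, so each weight along \<open>j\<close> is the matching factor of the
  target.\<close>

lemma unnormalised_target_selected_path:
  assumes "1 \<le> T" "\<forall>t\<in>{1..T-1}. A t (j (t + 1)) = j t"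
  shows "unnormalised_target T m1 m G (selected_path T z j) =
    (\<Prod>t=1..T. particle_weight m1 m G z A t (j t))"
proof -
  let ?x = "selected_path T z j"
  have "m t (?x (t - 1)) (?x t) * G t (?x t) = particle_weight m1 m G z A t (j t)"
    if "t \<in> {2..T}" for t
  proof -
    have "t - 1 \<in> {1..T-1}" "t - 1 + 1 = t"
      using that by auto
    then have "A (t - 1) (j t) = j (t - 1)"
      using assms(2) by metis
    then show ?thesis
      using that by (auto simp: selected_path_def particle_weight_def)
  qed
  moreover have "m1 (?x 1) * G 1 (?x 1) = particle_weight m1 m G z A 1 (j 1)"
    using assms by (simp add: selected_path_def particle_weight_def)
  moreover have "{1..T} = insert 1 {2..T}"
    using assms by auto
  ultimately show ?thesis
    by (simp add: unnormalised_target_def)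
qed

section \<open>Factorisation of the joint law of reference path and ancestors\<close>

theorem proposition4p1:
  fixes N T :: nat
    and m1 :: "real^'d \<Rightarrow> real"
    and m :: "nat \<Rightarrow> real^'d \<Rightarrow> real^'d \<Rightarrow> real"
    and G :: "nat \<Rightarrow> real^'d \<Rightarrow> real"
    and z :: "nat \<Rightarrow> nat \<Rightarrow> real^'d"
    and Q :: "(nat \<Rightarrow> nat) \<Rightarrow> (nat \<Rightarrow> nat) pmf"
  assumes "1 \<le> T"
    and "prob_density lborel m1"
    and "\<And>t. t \<in> {2..T} \<Longrightarrow> transition_density (m t)"
    and "\<And>t. t \<in> {1..T} \<Longrightarrow> G t \<in> borel_measurable borel"
    and "\<And>t x. t \<in> {1..T} \<Longrightarrow> 0 < G t x"
    and "prob_density (\<Pi>\<^sub>M t\<in>{1..T}. lborel) (target_density T m1 m G)"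
    and "0 < (\<Sum>l\<in>index_paths N T. target_density T m1 m G (selected_path T z l))"
    and "\<And>j. j \<in> index_paths N T \<Longrightarrow> 0 < pmf (xi N T m1 m G z) j \<Longrightarrow>
           Q j = csmc_kernel N T m1 m G z j"
  shows "bind_pmf (xi N T m1 m G z) Q = xi N T m1 m G z"
proof -
  let ?w = "particle_weight m1 m G z"
  let ?R = "\<lambda>j. resampling_pmf N m1 m G z j (T - 1)"
  let ?U = "?R (\<lambda>_. Suc N)"
  let ?S = "\<lambda>A t. \<Sum>l=0..N. ?w A t l"
  let ?p = "\<lambda>A. categorical_pmf {0..N} (?w A T)"
  let ?c = "\<integral>y. unnormalised_target T m1 m G y \<partial>(\<Pi>\<^sub>M t\<in>{1..T}. lborel)"
  let ?Z = "\<Sum>l\<in>index_paths N T. target_density T m1 m G (selected_path T z l)"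
  \<comment> \<open>The candidate for the marginal law of \<open>A\<close>, free of
    \<open>j\<close>. The constant \<open>?c\<close> normalises the target and \<open>?Z\<close> its
    restriction to the particles.\<close>
  let ?h = "\<lambda>A. pmf ?U A * (\<Prod>t=1..T. ?S A t) / (?c * ?Z)"
  have m1_nonneg: "0 \<le> m1 x" for x
    using assms(2) by (simp add: prob_density_def)
  have m_nonneg: "0 \<le> m t x y" if "t \<in> {2..T}" for t x y
    using assms(3)[OF that] by (simp add: transition_density_def prob_density_def)
  have G_nonneg: "0 \<le> G t x" if "t \<in> {1..T}" for t x
    using assms(5)[OF that] by (simp add: less_imp_le)
  have w_nonneg: "0 \<le> ?w A t l" if "t \<in> {1..T}" for A t l
    using that m1_nonneg m_nonneg G_nonneg by (auto simp: particle_weight_def)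
  have "0 \<le> unnormalised_target T m1 m G x" for x
    unfolding unnormalised_target_def using assms(1)
    by (intro mult_nonneg_nonneg prod_nonneg ballI m1_nonneg m_nonneg G_nonneg) auto
  then have c_nonneg: "0 \<le> ?c" and target_nonneg: "0 \<le> target_density T m1 m G x" for x
    by (auto simp: target_density_def)
  have xi: "pmf (xi N T m1 m G z) j =
      (if j \<in> index_paths N T then target_density T m1 m G (selected_path T z j) / ?Z else 0)" for j
    unfolding xi_def using assms(7) target_nonneg
    by (intro pmf_categorical_pmf) (auto simp: index_paths_def intro: finite_PiE)
  have T: "{1..T} = insert T {1..T-1}" "T \<notin> {1..T-1}"
    using assms(1) by auto
  have kernel: "csmc_kernel N T m1 m G z j =
      bind_pmf (?R j) (\<lambda>A. map_pmf (trace_ancestors T A) (?p A))" for j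
    by (simp add: csmc_kernel_def map_pmf_def)
  have joint: "pmf (xi N T m1 m G z) j * pmf (?R j) A =
      ?h A * pmf (map_pmf (trace_ancestors T A) (?p A)) j" for j A
  proof (cases "j \<in> index_paths N T")
    case True
    then have range: "j t \<le> N" if "t \<in> {1..T}" for t
      using that by (auto simp: index_paths_def)
    have ext: "j \<in> extensional {1..T}"
      using True by (auto simp: index_paths_def PiE_def)
    note traced = trace_ancestors_eq_iff[OF assms(1) ext, of A]
    have final: "?S A T * pmf (?p A) (j T) = ?w A T (j T)"
      using w_nonneg range assms(1) by (intro categorical_pmf_sum_times) auto
    show ?thesis
    proof (cases "trace_ancestors T A (j T) = j")
      case traces: True
      have reference: "pmf (?R j) A * (\<Prod>t=1..T-1. ?w A t (j t)) =
          pmf ?U A * (\<Prod>t=1..T-1. ?S A t)"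
        using w_nonneg range assms(1) traces traced
        by (intro pmf_resampling_pmf_reference) auto
      have "pmf (xi N T m1 m G z) j = (\<Prod>t=1..T. ?w A t (j t)) / (?c * ?Z)"
        using True assms(1) traced traces unnormalised_target_selected_path[of T A j m1 m G z]
        by (simp add: xi target_density_def)
      then have "pmf (xi N T m1 m G z) j * pmf (?R j) A =
          (pmf (?R j) A * (\<Prod>t=1..T-1. ?w A t (j t))) * ?w A T (j T) / (?c * ?Z)"
        unfolding T(1) using T(2) by simp
      \<comment> \<open>Nothing is forced at time \<open>T\<close>, so the last weight leaves,
        besides its total, the probability of selecting \<open>j T\<close>.\<close>
      also have "\<dots> = ?h A * pmf (?p A) (j T)"
        unfolding reference final[symmetric] T(1) using T(2) by simp
      finally show ?thesis
        using traces by (simp add: pmf_map_trace_ancestors[OF assms(1)])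
    next
      \<comment> \<open>Both sides vanish: resampling given \<open>j\<close> never produces this
        \<open>A\<close>, and tracing through \<open>A\<close> never produces
        \<open>j\<close>.\<close>
      case False
      then obtain t where t: "t \<in> {1..T-1}" "A t (j (t + 1)) \<noteq> j t"
        using traced by blast
      then have "A \<notin> set_pmf (?R j)"
        using range[of "t + 1"] resampling_pmf_traces_reference[of A N m1 m G z j "T - 1" t] by auto
      with False show ?thesis
        by (simp add: pmf_map_trace_ancestors[OF assms(1)] pmf_eq_0_set_pmf)
    qed
  next
    case False
    \<comment> \<open>If this were nonzero, all total weights in \<open>?h A\<close> would be
      nonzero. Then no unspecified distribution occurs, all indices stay in range, and the traced
      path \<open>j\<close> would be an index path.\<close>
    have "?h A * pmf (map_pmf (trace_ancestors T A) (?p A)) j = 0"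
    proof (rule ccontr)
      assume "\<not> ?thesis"
      then have A: "A \<in> set_pmf ?U" and S: "\<And>t. t \<in> {1..T} \<Longrightarrow> ?S A t \<noteq> 0"
        and j: "j \<in> trace_ancestors T A ` set_pmf (?p A)"
        by (auto simp: set_pmf_iff[of ?U] pmf_eq_0_set_pmf)
      have "A t n \<le> N" if "t \<in> {1..T-1}" "n \<le> N" for t n
        using A that S w_nonneg by (intro resampling_pmf_range[of A N m1 m G z "T - 1"]) auto
      moreover have "set_pmf (?p A) \<subseteq> {0..N}"
        using S w_nonneg assms(1) by (intro set_categorical_pmf_subset) auto
      ultimately show False
        using j False trace_ancestors_in_index_paths[of _ N T A] by fastforce
    qed
    with False show ?thesis
      by (simp add: xi)
  qed
  \<comment> \<open>Only values of \<open>Q\<close> on the support of \<open>xi\<close> enter, and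
    there it is the kernel.\<close>
  have "bind_pmf (xi N T m1 m G z) Q = bind_pmf (xi N T m1 m G z) (csmc_kernel N T m1 m G z)"
  proof (rule bind_pmf_cong[OF refl])
    fix j assume j: "j \<in> set_pmf (xi N T m1 m G z)"
    then have "j \<in> index_paths N T"
      by (auto simp: set_pmf_iff xi split: if_splits)
    then show "Q j = csmc_kernel N T m1 m G z j"
      using assms(8) j by (simp add: pmf_positive)
  qed
  also have "\<dots> = xi N T m1 m G z"
    unfolding kernel
  proof (rule bind_pmf_invariantI[OF _ joint])
    show "0 \<le> ?h A" for A
      using assms(7) c_nonneg w_nonneg target_nonneg
      by (intro divide_nonneg_nonneg mult_nonneg_nonneg prod_nonneg sum_nonneg ballI) auto
  qed
  finally show ?thesis .
qed

end
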